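(* Let $A\in\mathbb R^{n\times n}$, $B\in\mathbb R^{n\times m}$, $C\in\mathbb R^{m\times n}$. Let $\theta\in\mathcal K_\infty$ and $\alpha\in\mathcal P$ with $\alpha\le\theta$ be such that $s\mapsto r(s):=\sqrt{\theta^2(s)-\alpha^2(s)}$ is non-decreasing and locally Lipschitz on $\mathbb R_+$. Define the correspondence $$F_0(y):=\big\{w\in\mathbb R^m:\ \|w\|\le\theta(\|y\|)\ \text{and}\ \langle w,y\rangle\ge\|y\|\alpha(\|y\|)\big\},\quad y\in\mathbb R^m,$$ and consider the forced Lur'e inclusion $$\dot x(t)-Ax(t)-Bv(t)\in -BF_0(Cx(t)),\quad t\ge 0.\qquad(\ast)$$ Assume that the pair $(C,A)$ is detectable and that there exists a symmetric positive definite $P\in\mathbb R^{n\times n}$ such that $$\begin{pmatrix}A^\top P+PA & PB-C^\top\\ B^\top P-C & 0\end{pmatrix}\le 0.$$ Then $(\ast)$ is Integral Input-to-State Stable (IISS) with linear IISS gain, that is, there exist $\psi\in\mathcal{KL}$ and $\phi\in\mathcal K$ such that $$\|x(t)\|\le\psi(\|x(0)\|,t)+\phi\Big(\int_0^t\|v(s)\|\,{\rm d}s\Big)\quad\forall\,t\ge0,\ \forall\,(v,x)\in\mathcal B_{\rm inc},$$ and $\psi,\phi$ depend only on $(A,B,C)$, $\theta$ and $\alpha$.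
   Context: $\|\cdot\|$ is the Euclidean norm induced by $\langle\cdot,\cdot\rangle$. $\mathcal P$ is the set of continuous functions $\mathbb R_+\to\mathbb R_+$ which vanish at $0$ and are positive for positive arguments; $\mathcal K\subset\mathcal P$ is the subset of strictly increasing functions; $\mathcal K_\infty$ is the set of unbounded functions in $\mathcal K$. $\mathcal{KL}$ is the set of functions $\psi:\mathbb R_+\times\mathbb R_+\to\mathbb R_+$ such that $\psi(\cdot,t)\in\mathcal K$ for each $t$, and for each $s$ the function $\psi(s,\cdot)$ is non-increasing with $\psi(s,t)\to0$ as $t\to\infty$. Matrix inequalities are in the sense of symmetric (semi-)definiteness. $(C,A)$ is detectable if there is $H$ with $A-HC$ Hurwitz. $\mathcal B_{\rm inc}$ is the set of pairs $(v,x)\in L^1_{\rm loc}(\mathbb R_+,\mathbb R^m)\times W^{1,1}_{\rm loc}(\mathbb R_+,\mathbb R^n)$ satisfying $(\ast)$ for almost every $t\ge0$. *)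

theory Defs
  imports "HOL-Analysis.Analysis"
begin

section \<open>Comparison functions\<close>

text \<open>
  A function on the half-line is represented by a total function on the reals, of which only the
  values at non-negative arguments matter.
\<close>

definition class_P :: "(real \<Rightarrow> real) set" where
  "class_P = {f. continuous_on {0..} f \<and> f 0 = 0 \<and> (\<forall>s>0. f s > 0)}"

definition class_K :: "(real \<Rightarrow> real) set" where
  "class_K = {f \<in> class_P. strict_mono_on {0..} f}"

definition class_K_inf :: "(real \<Rightarrow> real) set" where
  "class_K_inf = {f \<in> class_K. \<not> bounded (f ` {0..})}"

definition class_KL :: "(real \<Rightarrow> real \<Rightarrow> real) set" where
  "class_KL = {\<psi>. (\<forall>t\<ge>0. (\<lambda>s. \<psi> s t) \<in> class_K) \<and>
                  (\<forall>s\<ge>0. antimono_on {0..} (\<psi> s) \<and> (\<psi> s \<longlongrightarrow> 0) at_top)}"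

section \<open>Matrices\<close>

definition hurwitz :: "real^'n^'n \<Rightarrow> bool" where
  "hurwitz M \<longleftrightarrow>
     (\<forall>(\<mu>::complex) (z::complex^'n).
        z \<noteq> 0 \<and> map_matrix complex_of_real M *v z = \<mu> *s z \<longrightarrow> Re \<mu> < 0)"

definition detectable :: "real^'n^'m \<Rightarrow> real^'n^'n \<Rightarrow> bool" where
  "detectable C A \<longleftrightarrow> (\<exists>H::real^'m^'n. hurwitz (A - H ** C))"

definition pos_definite :: "real^'n^'n \<Rightarrow> bool" where
  "pos_definite M \<longleftrightarrow> transpose M = M \<and> (\<forall>z. z \<noteq> 0 \<longrightarrow> z \<bullet> (M *v z) > 0)"

definition neg_semidefinite :: "real^'n^'n \<Rightarrow> bool" where
  "neg_semidefinite M \<longleftrightarrow> transpose M = M \<and> (\<forall>z. z \<bullet> (M *v z) \<le> 0)"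

definition block_matrix ::
  "real^'n^'n \<Rightarrow> real^'m^'n \<Rightarrow> real^'n^'m \<Rightarrow> real^'m^'m \<Rightarrow> real^('n::finite + 'm::finite)^('n + 'm)" where
  "block_matrix M11 M12 M21 M22 =
     (\<chi> i j. case i of
        Inl a \<Rightarrow> (case j of Inl b \<Rightarrow> M11 $ a $ b | Inr b \<Rightarrow> M12 $ a $ b)
      | Inr a \<Rightarrow> (case j of Inl b \<Rightarrow> M21 $ a $ b | Inr b \<Rightarrow> M22 $ a $ b))"

section \<open>Function spaces on the half-line\<close>

definition L1_loc :: "(real \<Rightarrow> 'a::euclidean_space) set" where
  "L1_loc = {f. \<forall>T\<ge>0. f absolutely_integrable_on {0..T}}"

text \<open>
  The space \<open>W\<^sup>1\<^sup>,\<^sup>1\<close> (local) consists of the locally absolutely continuous functions, that is, of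
  the functions \<open>x\<close> for which there is a locally integrable \<open>dx\<close>, unique up to null sets,
  of which \<open>x\<close> is an antiderivative. This \<open>dx\<close> is the derivative of \<open>x\<close>, in the weak sense and
  in the pointwise sense almost everywhere.
\<close>

definition has_L1_loc_derivative ::
  "(real \<Rightarrow> 'a::euclidean_space) \<Rightarrow> (real \<Rightarrow> 'a) \<Rightarrow> bool" where
  "has_L1_loc_derivative x dx \<longleftrightarrow> dx \<in> L1_loc \<and> (\<forall>t\<ge>0. x t = x 0 + integral {0..t} dx)"

section \<open>The forced Lur'e inclusion\<close>

definition F0 :: "(real \<Rightarrow> real) \<Rightarrow> (real \<Rightarrow> real) \<Rightarrow> real^'m \<Rightarrow> (real^'m) set" where
  "F0 \<theta> \<alpha> y = {w. norm w \<le> \<theta> (norm y) \<and> w \<bullet> y \<ge> norm y * \<alpha> (norm y)}"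

definition B_inc ::
  "real^'n^'n \<Rightarrow> real^'m^'n \<Rightarrow> real^'n^'m \<Rightarrow> (real^'m \<Rightarrow> (real^'m) set) \<Rightarrow>
   ((real \<Rightarrow> real^'m) \<times> (real \<Rightarrow> real^'n)) set" where
  "B_inc A B C F =
     {(v, x). v \<in> L1_loc \<and>
        (\<exists>dx. has_L1_loc_derivative x dx \<and>
           (AE t in lebesgue. t \<ge> 0 \<longrightarrow>
              dx t - A *v x t - B *v v t \<in> (\<lambda>w. - (B *v w)) ` F (C *v x t)))}"

text \<open>
  Integral input-to-state stability with linear gain: the input enters through the integral of
  its norm itself, with no comparison function applied to the norm.
\<close>

definition IISS_linear_gain :: "((real \<Rightarrow> real^'m) \<times> (real \<Rightarrow> real^'n)) set \<Rightarrow> bool" where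
  "IISS_linear_gain \<B> \<longleftrightarrow>
     (\<exists>\<psi>\<in>class_KL. \<exists>\<phi>\<in>class_K. \<forall>(v, x)\<in>\<B>. \<forall>t\<ge>0.
        norm (x t) \<le> \<psi> (norm (x 0)) t + \<phi> (integral {0..t} (\<lambda>s. norm (v s))))"

end

theory Submission
  imports Defs "HOL-Computational_Algebra.Fundamental_Theorem_Algebra"
begin

text \<open>
  The block inequality forces \<open>P ** B = transpose C\<close>, so \<open>N x = sqrt (x \<bullet> (P *v x))\<close> satisfies
  \<open>N (x t) \<le> N (x a) + 2 * c * D\<close>, where \<open>D\<close> is the integral of \<open>norm v\<close>, and the square of \<open>N\<close>
  dissipates \<open>norm y * \<alpha> (norm y)\<close> with \<open>y = C *v x\<close>. If \<open>D\<close> exceeds \<open>N (x 0)\<close>, this growth bound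
  already gives a linear gain. Otherwise the trajectory stays in a compact set. Detectability provides
  a second quadratic form that decreases up to terms in \<open>norm y + \<theta> (norm y)\<close>; on the compact set
  these are at most a small constant plus a multiple of \<open>norm y * \<alpha> (norm y)\<close>. A combination of the
  two forms therefore decreases at a fixed rate while \<open>N (x t) \<ge> \<epsilon>\<close>, so \<open>N\<close> falls below \<open>\<epsilon>\<close> within
  a uniform time, after which the growth bound applies again. Uniform boundedness and uniform
  attractivity together yield the \<open>KL\<close> estimate.
\<close>

section \<open>Lyapunov forms of Hurwitz matrices\<close>

text \<open>Any \<open>DIM('a) + 1\<close> vectors are dependent. The family is indexed, so a
  repeated value is treated separately: it gives the relation with coefficients 1 and -1.\<close>

lemma sequence_linearly_dependent:
  fixes f :: "nat \<Rightarrow> 'a::euclidean_space"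
  shows "\<exists>c::nat \<Rightarrow> real. \<exists>N. (\<exists>k\<le>N. c k \<noteq> 0) \<and> (\<Sum>k\<le>N. c k *\<^sub>R f k) = 0"
proof (cases "inj_on f {..DIM('a)}")
  case True
  then have "card (f ` {..DIM('a)}) > DIM('a)"
    by (simp add: card_image)
  then have "dependent (f ` {..DIM('a)})"
    by (intro dependent_biggerset) auto
  then obtain u where u: "\<exists>v\<in>f ` {..DIM('a)}. u v \<noteq> 0" "(\<Sum>v\<in>f ` {..DIM('a)}. u v *\<^sub>R v) = 0"
    by (auto simp: real_vector.dependent_finite)
  then have "(\<Sum>k\<le>DIM('a). u (f k) *\<^sub>R f k) = 0"
    using True by (simp add: sum.reindex)
  with u(1) show ?thesis
    by (intro exI[of _ "u \<circ> f"] exI[of _ "DIM('a)"]) auto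
next
  case False
  then obtain i j where ij: "i \<le> DIM('a)" "j \<le> DIM('a)" "i \<noteq> j" "f i = f j"
    by (auto simp: inj_on_def)
  define c :: "nat \<Rightarrow> real" where "c k = (if k = i then 1 else 0) - (if k = j then 1 else 0)" for k
  have "(\<Sum>k\<le>DIM('a). c k *\<^sub>R f k) =
    (\<Sum>k\<le>DIM('a). if k = i then f k else 0) - (\<Sum>k\<le>DIM('a). if k = j then f k else 0)"
    unfolding sum_subtractf[symmetric] by (intro sum.cong) (auto simp: c_def)
  then have "(\<Sum>k\<le>DIM('a). c k *\<^sub>R f k) = 0"
    using ij by simp
  moreover have "c i \<noteq> 0"
    using ij by (simp add: c_def)
  ultimately show ?thesis
    using ij by (intro exI[of _ c] exI[of _ "DIM('a)"]) auto
qed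

text \<open>This is the vector \<open>p(M) z\<close>, written with iterates of the action of
  \<open>M\<close> on \<open>z\<close>.\<close>

definition poly_matrix_vector ::
  "complex poly \<Rightarrow> complex^'n^'n \<Rightarrow> complex^'n \<Rightarrow> complex^'n" where
  "poly_matrix_vector p M z = (\<Sum>i\<le>degree p. coeff p i *s (((*v) M ^^ i) z))"

lemma poly_matrix_vector_eq_sum:
  assumes "degree p \<le> N"
  shows "poly_matrix_vector p M z = (\<Sum>i\<le>N. coeff p i *s (((*v) M ^^ i) z))"
  unfolding poly_matrix_vector_def using assms
  by (intro sum.mono_neutral_left) (auto simp: coeff_eq_0)

lemma matrix_vector_mult_sum:
  fixes M :: "'a::comm_ring_1^'n^'m"
  shows "M *v (\<Sum>i\<in>I. f i) = (\<Sum>i\<in>I. M *v f i)"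
  by (induction I rule: infinite_finite_induct) (simp_all add: matrix_vector_right_distrib)

lemma matrix_power_commute:
  fixes M :: "complex^'n^'n"
  shows "((*v) M ^^ i) (M *v z - c *s z) = M *v ((*v) M ^^ i) z - c *s ((*v) M ^^ i) z"
  by (induction i)
     (simp_all add: matrix_vector_mult_diff_distrib vector_scalar_commute)

lemma poly_matrix_vector_commute:
  "poly_matrix_vector p M (M *v z - c *s z) =
     M *v poly_matrix_vector p M z - c *s poly_matrix_vector p M z"
  unfolding poly_matrix_vector_def
  by (simp add: matrix_vector_mult_sum matrix_power_commute vector_scalar_commute
      vec.scale_sum_right sum_subtractf[symmetric] vec.scale_right_diff_distrib mult.commute)

text \<open>The coefficients of the product are the shifted ones minus \<open>c\<close> times the
  old ones, and the shift is one more application of \<open>M\<close>. This allows roots to be split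
  off one at a time.\<close>

lemma poly_matrix_vector_linear_factor:
  "poly_matrix_vector ([:- c, 1:] * q) M z =
     M *v poly_matrix_vector q M z - c *s poly_matrix_vector q M z"
proof -
  let ?n = "degree q"
  let ?T = "\<lambda>i. ((*v) M ^^ i) z"
  have coeff: "coeff ([:- c, 1:] * q) i = coeff (pCons 0 q) i - c * coeff q i" for i
    by simp
  have "degree ([:- c, 1:] * q) \<le> Suc ?n"
    by (rule order_trans[OF degree_mult_le]) simp
  then have "poly_matrix_vector ([:- c, 1:] * q) M z =
    (\<Sum>i\<le>Suc ?n. coeff ([:- c, 1:] * q) i *s ?T i)"
    by (rule poly_matrix_vector_eq_sum)
  also have "\<dots> = (\<Sum>i\<le>Suc ?n. coeff (pCons 0 q) i *s ?T i) - c *s (\<Sum>i\<le>Suc ?n. coeff q i *s ?T i)"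
    unfolding coeff
    by (simp only: vec.scale_left_diff_distrib sum_subtractf vec.scale_sum_right vec.scale_scale)
  also have "(\<Sum>i\<le>Suc ?n. coeff q i *s ?T i) = poly_matrix_vector q M z"
    by (rule poly_matrix_vector_eq_sum[symmetric]) simp
  also have "(\<Sum>i\<le>Suc ?n. coeff (pCons 0 q) i *s ?T i) = M *v poly_matrix_vector q M z"
    unfolding sum.atMost_Suc_shift
    by (simp add: poly_matrix_vector_def matrix_vector_mult_sum vector_scalar_commute)
  finally show ?thesis .
qed

text \<open>The powers of \<open>M\<close> lie in a finite-dimensional real vector space, so a
  nontrivial real combination of them vanishes.\<close>

lemma annihilating_poly_exists:
  fixes M :: "complex^'n^'n"
  shows "\<exists>p. p \<noteq> 0 \<and> (\<forall>z. poly_matrix_vector p M z = 0)"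
proof -
  define MP where "MP k = (((**) M) ^^ k) (mat 1)" for k
  have MP: "MP k *v z = ((*v) M ^^ k) z" for k z
    by (induction k) (simp_all add: MP_def matrix_vector_mul_assoc[symmetric])
  obtain c :: "nat \<Rightarrow> real" and N k where c: "k \<le> N" "c k \<noteq> 0" "(\<Sum>k\<le>N. c k *\<^sub>R MP k) = 0"
    using sequence_linearly_dependent[of MP] by blast
  define p where "p = (\<Sum>k\<le>N. monom (complex_of_real (c k)) k)"
  have coeff_p: "coeff p i = (if i \<le> N then of_real (c i) else 0)" for i
    by (simp add: p_def coeff_sum if_distrib cong: if_cong)
  have "degree p \<le> N"
    by (rule degree_le) (simp add: coeff_p)
  have "poly_matrix_vector p M z = 0" for z
  proof -
    have lin: "linear (\<lambda>X. X *v z)"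
      by (auto intro!: linearI simp: matrix_vector_mult_add_rdistrib)
         (simp add: vec_eq_iff matrix_vector_mult_def scaleR_sum_right)
    have "poly_matrix_vector p M z = (\<Sum>i\<le>N. c i *\<^sub>R (MP i *v z))"
      unfolding poly_matrix_vector_eq_sum[OF \<open>degree p \<le> N\<close>] MP
      by (intro sum.cong) (auto simp: coeff_p vec_eq_iff scaleR_conv_of_real[where 'a=complex])
    also have "\<dots> = (\<Sum>k\<le>N. c k *\<^sub>R MP k) *v z"
      using linear_sum[OF lin, of "\<lambda>k. c k *\<^sub>R MP k" "{..N}"] by (simp add: linear_cmul[OF lin])
    finally show ?thesis
      using c(3) by simp
  qed
  moreover have "p \<noteq> 0"
    using c coeff_p[of k] by auto
  ultimately show ?thesis by blast
qed

text \<open>The inner product on \<open>complex^'n\<close> is the real one, so only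
  \<open>Re c\<close> survives. This is how the sign of the real part of a root enters.\<close>

lemma inner_smult_complex:
  fixes z :: "complex^'n"
  shows "z \<bullet> (c *s z) = Re c * (norm z)\<^sup>2"
proof -
  have "w \<bullet> (c * w) = Re c * (w \<bullet> w)" for w :: complex
    by (simp add: inner_complex_def algebra_simps)
  then show ?thesis
    by (simp add: power2_norm_eq_inner inner_vec_def sum_distrib_left)
qed

lemma norm_smult_complex:
  fixes z :: "complex^'n"
  shows "norm (c *s z) = cmod c * norm z"
  by (simp add: norm_vec_def L2_set_def norm_mult power_mult_distrib
      sum_distrib_left[symmetric] real_sqrt_mult)

lemma linear_matrix_minus_scalar:
  fixes M :: "complex^'n^'n"
  shows "linear (\<lambda>z. M *v z - c *s z)"
proof (rule linearI)
  show "M *v (x + y) - c *s (x + y) = M *v x - c *s x + (M *v y - c *s y)" for x y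
    by (simp add: matrix_vector_right_distrib vector_add_ldistrib)
  show "M *v (r *\<^sub>R x) - c *s (r *\<^sub>R x) = r *\<^sub>R (M *v x - c *s x)" for r x
    by (simp add: vec_eq_iff matrix_vector_mult_def scaleR_sum_right scaleR_diff_right)
qed

section \<open>Constructions of bilinear forms\<close>

lemma bilinear_compose:
  assumes "bilinear b" "linear f" "linear g"
  shows "bilinear (\<lambda>x y. b (f x) (g y))"
  using assms unfolding bilinear_def
  by (auto intro: linear_compose[unfolded o_def, OF assms(3)]
      linear_compose[unfolded o_def, OF assms(2), of "\<lambda>x. b x _"])

lemma bilinear_add:
  "bilinear b \<Longrightarrow> bilinear b' \<Longrightarrow> bilinear (\<lambda>x y. b x y + b' x y)"
  unfolding bilinear_def by (auto intro: linear_compose_add)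

lemma bilinear_cmult:
  fixes b :: "_ \<Rightarrow> _ \<Rightarrow> real"
  shows "bilinear b \<Longrightarrow> bilinear (\<lambda>x y. c * b x y)"
  by (simp add: bilinear_def linear_iff algebra_simps)

lemma bilinear_inner: "bilinear ((\<bullet>) :: 'a::euclidean_space \<Rightarrow> 'a \<Rightarrow> real)"
  by (simp add: bilinear_conv_bounded_bilinear bounded_bilinear_inner)

text \<open>
  The linear factors of the polynomial are removed one at a time. A factor \<open>X - c\<close> with
  \<open>Re c \<ge> 0\<close> acts injectively and only changes \<open>K\<close>; for a factor with \<open>Re c < 0\<close> the
  form is enlarged by multiples of \<open>z \<mapsto> norm z ^ 2\<close> and of the form for the remaining
  factors, evaluated at \<open>M *v z - c *s z\<close>.
\<close>

lemma lyapunov_form_up_to_poly: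
  fixes M :: "complex^'n^'n"
  assumes hur: "\<And>c z. z \<noteq> 0 \<Longrightarrow> M *v z = c *s z \<Longrightarrow> Re c < 0"
    and "p \<noteq> 0"
  shows "\<exists>b K. bilinear b \<and> (\<forall>x y. b x y = b y x) \<and> (\<forall>z. 0 \<le> b z z) \<and> 0 \<le> K \<and>
           (\<forall>z. 2 * b z (M *v z) \<le> K * (norm (poly_matrix_vector p M z))\<^sup>2 - (norm z)\<^sup>2)"
  using \<open>p \<noteq> 0\<close>
proof (induction "degree p" arbitrary: p)
  case 0
  then obtain a where a: "p = [:a:]" "a \<noteq> 0"
    by (metis degree_eq_zeroE pCons_0_0)
  \<comment> \<open>For a nonzero constant polynomial the zero form works, as \<open>norm z\<close>
    is a multiple of the norm of \<open>p(M) z\<close>.\<close>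
  have "poly_matrix_vector p M z = a *s z" for z
    by (simp add: a poly_matrix_vector_def)
  then have "1 / (cmod a)\<^sup>2 * (norm (poly_matrix_vector p M z))\<^sup>2 = (norm z)\<^sup>2" for z
    using a by (simp add: norm_smult_complex power_mult_distrib)
  then show ?case
    by (intro exI[of _ "\<lambda>x y. 0"] exI[of _ "1 / (cmod a)\<^sup>2"])
       (simp add: bilinear_def linear_zero)
next
  case (Suc n)
  have "\<not> constant (poly p)"
    using Suc.hyps by (simp add: constant_degree)
  then obtain c where "poly p c = 0"
    using fundamental_theorem_of_algebra by blast
  then obtain q where q: "p = [:- c, 1:] * q"
    by (auto simp: poly_eq_0_iff_dvd)
  with Suc.prems have "q \<noteq> 0" by auto
  then have "degree p = Suc (degree q)"
    unfolding q by (subst degree_mult_eq) auto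
  then have "n = degree q"
    using Suc.hyps by simp
  from Suc.hyps(1)[OF this \<open>q \<noteq> 0\<close>] obtain b K where
    b: "bilinear b" "\<And>x y. b x y = b y x" "\<And>z. 0 \<le> b z z" "0 \<le> K"
    and bM: "\<And>z. 2 * b z (M *v z) \<le> K * (norm (poly_matrix_vector q M z))\<^sup>2 - (norm z)\<^sup>2"
    by blast
  let ?L = "\<lambda>z. M *v z - c *s z"
  have L: "linear ?L"
    by (rule linear_matrix_minus_scalar)
  have pL: "poly_matrix_vector p M z = ?L (poly_matrix_vector q M z)" for z
    unfolding q by (rule poly_matrix_vector_linear_factor)
  show ?case
  proof (cases "Re c < 0")
    case True
    define a where "a = - Re c"
    then have "a > 0"
      using True by simp
    \<comment> \<open>Since \<open>z \<bullet> (M *v z) = z \<bullet> ?L z - a * (norm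
      z)\<^sup>2\<close>, Young's inequality leaves an error \<open>(norm (?L z))\<^sup>2\<close>,
      which the decay of \<open>b\<close> at \<open>?L z\<close> cancels. The weights normalise the
      remaining decay to \<open>(norm z)\<^sup>2\<close>.\<close>
    define b' where "b' x y = (1 / a) * (x \<bullet> y) + (1 / a\<^sup>2) * b (?L x) (?L y)" for x y
    have "bilinear b'"
      unfolding b'_def[abs_def]
      by (intro bilinear_add bilinear_cmult bilinear_inner bilinear_compose[OF b(1)] L)
    moreover have "b' x y = b' y x" for x y
      unfolding b'_def by (simp add: b(2)[of "?L x" "?L y"] inner_commute)
    moreover have "0 \<le> b' z z" for z
      unfolding b'_def using \<open>a > 0\<close> by (intro add_nonneg_nonneg mult_nonneg_nonneg b(3)) auto
    moreover have "2 * b' z (M *v z) \<le>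
        (K / a\<^sup>2) * (norm (poly_matrix_vector p M z))\<^sup>2 - (norm z)\<^sup>2" for z
    proof -
      have "2 * a * (z \<bullet> ?L z) \<le> a\<^sup>2 * (norm z)\<^sup>2 + (norm (?L z))\<^sup>2"
      proof -
        have "0 \<le> (a *\<^sub>R z - ?L z) \<bullet> (a *\<^sub>R z - ?L z)"
          by simp
        then show ?thesis
          unfolding power2_norm_eq_inner
          by (simp only: inner_diff_left inner_diff_right inner_scaleR_left inner_scaleR_right)
             (simp add: inner_commute power2_eq_square algebra_simps)
      qed
      moreover have "z \<bullet> (M *v z) = z \<bullet> ?L z - a * (norm z)\<^sup>2"
        by (simp add: inner_diff_right inner_smult_complex a_def)
      then have "2 * a * (z \<bullet> (M *v z)) = 2 * a * (z \<bullet> ?L z) - 2 * (a\<^sup>2 * (norm z)\<^sup>2)"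
        by (simp only: power2_eq_square) (simp only: right_diff_distrib mult.assoc)
      ultimately have "2 * a * (z \<bullet> (M *v z)) \<le> (norm (?L z))\<^sup>2 - a\<^sup>2 * (norm z)\<^sup>2"
        by linarith
      moreover have "?L (M *v z) = M *v ?L z"
        by (simp add: matrix_vector_mult_diff_distrib vector_scalar_commute)
      then have "2 * b (?L z) (?L (M *v z)) \<le>
          K * (norm (poly_matrix_vector p M z))\<^sup>2 - (norm (?L z))\<^sup>2"
        using bM[of "?L z"] by (simp add: poly_matrix_vector_commute pL)
      ultimately have "2 * a * (z \<bullet> (M *v z)) + 2 * b (?L z) (?L (M *v z)) \<le>
          K * (norm (poly_matrix_vector p M z))\<^sup>2 - a\<^sup>2 * (norm z)\<^sup>2"
        by linarith
      then have "(2 * a * (z \<bullet> (M *v z)) + 2 * b (?L z) (?L (M *v z))) / a\<^sup>2 \<le>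
          (K * (norm (poly_matrix_vector p M z))\<^sup>2 - a\<^sup>2 * (norm z)\<^sup>2) / a\<^sup>2"
        by (rule divide_right_mono) simp
      then show ?thesis
        using \<open>a > 0\<close>
        by (simp only: b'_def add_divide_distrib diff_divide_distrib)
           (simp add: power2_eq_square field_simps)
    qed
    ultimately show ?thesis
      using \<open>0 \<le> K\<close> by (intro exI[of _ b'] exI[of _ "K / a\<^sup>2"]) auto
  next
    case False
    \<comment> \<open>A nonzero kernel vector would be an eigenvector for \<open>c\<close>, although
      \<open>Re c \<ge> 0\<close>. In finite dimension, injectivity gives the lower bound
      \<open>m\<close>.\<close>
    have "inj ?L"
      unfolding linear_injective_0[OF L] using hur[of _ c] False by auto
    then obtain m where m: "m > 0" "\<And>z. m * norm z \<le> norm (?L z)"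
      using linear_inj_bounded_below_pos[OF L] by blast
    have "2 * b z (M *v z) \<le> (K / m\<^sup>2) * (norm (poly_matrix_vector p M z))\<^sup>2 - (norm z)\<^sup>2" for z
    proof -
      let ?q = "poly_matrix_vector q M z"
      have "(m * norm ?q)\<^sup>2 \<le> (norm (poly_matrix_vector p M z))\<^sup>2"
        unfolding pL using m by (intro power_mono) auto
      then have "K * (m * norm ?q)\<^sup>2 \<le> K * (norm (poly_matrix_vector p M z))\<^sup>2"
        using \<open>0 \<le> K\<close> by (rule mult_left_mono)
      then have "K * (norm ?q)\<^sup>2 \<le> (K / m\<^sup>2) * (norm (poly_matrix_vector p M z))\<^sup>2"
        using \<open>m > 0\<close> by (simp add: field_simps)
      with bM[of z] show ?thesis
        by linarith
    qed
    with b m show ?thesis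
      by (intro exI[of _ b] exI[of _ "K / m\<^sup>2"]) auto
  qed
qed

text \<open>An annihilating polynomial of the complexified matrix makes the \<open>K\<close> term
  vanish. The form is then pulled back along the inclusion \<open>cvec\<close> of real vectors,
  which is isometric and commutes with the matrices.\<close>

lemma hurwitz_imp_lyapunov_form:
  fixes M :: "real^'n^'n"
  assumes "hurwitz M"
  shows "\<exists>b. bilinear b \<and> (\<forall>x y. b x y = b y x) \<and> (\<forall>x. 0 \<le> b x x) \<and>
           (\<forall>x. 2 * b x (M *v x) \<le> - (norm x)\<^sup>2)"
proof -
  let ?M = "map_matrix complex_of_real M"
  define cvec :: "real^'n \<Rightarrow> complex^'n" where "cvec x = (\<chi> i. complex_of_real (x $ i))" for x
  have "linear cvec"
    by (rule linearI) (simp_all add: cvec_def vec_eq_iff scaleR_conv_of_real[where 'a=complex])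
  have cvec_mult: "cvec (M *v x) = ?M *v cvec x" for x
    by (simp add: cvec_def vec_eq_iff matrix_vector_mult_def map_matrix_def)
  have norm_cvec: "norm (cvec x) = norm x" for x
    by (simp add: cvec_def norm_vec_def)
  obtain p where p: "p \<noteq> 0" "\<And>z. poly_matrix_vector p ?M z = 0"
    using annihilating_poly_exists[of ?M] by blast
  have "\<And>c z. z \<noteq> 0 \<Longrightarrow> ?M *v z = c *s z \<Longrightarrow> Re c < 0"
    using assms unfolding hurwitz_def by blast
  then have "\<exists>b K. bilinear b \<and> (\<forall>x y. b x y = b y x) \<and> (\<forall>z. 0 \<le> b z z) \<and> 0 \<le> K \<and>
      (\<forall>z. 2 * b z (?M *v z) \<le> K * (norm (poly_matrix_vector p ?M z))\<^sup>2 - (norm z)\<^sup>2)"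
    using p(1) by (rule lyapunov_form_up_to_poly)
  with p(2) obtain b where
    b: "bilinear b" "\<And>x y. b x y = b y x" "\<And>z. 0 \<le> b z z"
      "\<And>z. 2 * b z (?M *v z) \<le> - (norm z)\<^sup>2"
    by auto
  have "2 * b (cvec x) (cvec (M *v x)) \<le> - (norm x)\<^sup>2" for x
    using b(4)[of "cvec x"] by (simp add: cvec_mult norm_cvec)
  with b bilinear_compose[OF b(1) \<open>linear cvec\<close> \<open>linear cvec\<close>] show ?thesis
    by (intro exI[of _ "\<lambda>x y. b (cvec x) (cvec y)"]) auto
qed

section \<open>Quadratic forms along locally absolutely continuous functions\<close>

lemma integral_mono_negligible:
  fixes f g :: "real \<Rightarrow> real"
  assumes "f integrable_on S" "g integrable_on S" "negligible N"
    and "\<And>s. s \<in> S - N \<Longrightarrow> f s \<le> g s"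
  shows "integral S f \<le> integral S g"
proof -
  let ?g = "\<lambda>s. if s \<in> N then f s else g s"
  have "?g integrable_on S"
    using assms(2,3) by (rule integrable_spike) auto
  then have "integral S f \<le> integral S ?g"
    using assms by (intro integral_le) auto
  also have "integral S ?g = integral S g"
    using assms(3) by (rule integral_spike) auto
  finally show ?thesis .
qed

text \<open>Cut the interval into equal pieces shorter than \<open>d\<close> and telescope.\<close>

lemma increment_le_of_local_increments:
  fixes F H :: "real \<Rightarrow> real"
  assumes "a \<le> t" "0 < d"
    and local: "\<And>u w. a \<le> u \<Longrightarrow> u \<le> w \<Longrightarrow> w \<le> t \<Longrightarrow> w - u < d \<Longrightarrow> F w - F u \<le> H w - H u"
  shows "F t - F a \<le> H t - H a"
proof -
  obtain n where n: "(t - a) / d < real n"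
    using reals_Archimedean2 by blast
  have "0 \<le> (t - a) / d"
    using assms by simp
  then have "n > 0"
    using n by (cases n) auto
  define h where "h = (t - a) / n"
  have h: "0 \<le> h" "h < d" "real n * h = t - a"
    using assms n \<open>n > 0\<close> by (auto simp: h_def field_simps)
  have "k \<le> n \<Longrightarrow> F (a + k * h) - F a \<le> H (a + k * h) - H a" for k
  proof (induction k)
    case (Suc k)
    have "real (Suc k) * h \<le> real n * h"
      using Suc.prems h(1) by (intro mult_right_mono) auto
    then have "F (a + Suc k * h) - F (a + k * h) \<le> H (a + Suc k * h) - H (a + k * h)"
      using h by (intro local) (auto simp: algebra_simps)
    with Suc show ?case by simp
  qed simp
  from this[of n] h(3) show ?thesis by simp
qed

section \<open>Locally absolutely continuous functions\<close>

lemma has_L1_loc_derivative_integrable: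
  assumes "has_L1_loc_derivative x dx" "0 \<le> a"
  shows "dx integrable_on {a..t}" "(\<lambda>s. norm (dx s)) integrable_on {a..t}"
proof -
  \<comment> \<open>The maximum covers negative \<open>t\<close>, for which \<open>{a..t}\<close> is
    empty.\<close>
  have "dx absolutely_integrable_on {0..max 0 t}"
    using assms(1) by (simp add: has_L1_loc_derivative_def L1_loc_def)
  then show "dx integrable_on {a..t}" "(\<lambda>s. norm (dx s)) integrable_on {a..t}"
    using assms(2) unfolding absolutely_integrable_on_def
    by (auto elim!: integrable_on_subinterval)
qed

lemma has_L1_loc_derivative_diff:
  assumes "has_L1_loc_derivative x dx" "0 \<le> u" "u \<le> w"
  shows "x w - x u = integral {u..w} dx"
proof -
  have x: "x s = x 0 + integral {0..s} dx" if "0 \<le> s" for s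
    using assms(1) that unfolding has_L1_loc_derivative_def by blast
  have "integral {0..u} dx + integral {u..w} dx = integral {0..w} dx"
    using assms has_L1_loc_derivative_integrable(1)[OF assms(1)]
    by (intro Henstock_Kurzweil_Integration.integral_combine) auto
  then show ?thesis
    using assms by (subst x[of u], simp, subst x[of w]) (simp_all add: algebra_simps)
qed

lemma has_L1_loc_derivative_continuous:
  assumes "has_L1_loc_derivative x dx"
  shows "continuous_on {0..t} x"
proof -
  have "continuous_on {0..t} (\<lambda>s. x 0 + integral {0..s} dx)"
    using has_L1_loc_derivative_integrable(1)[OF assms]
    by (intro continuous_intros indefinite_integral_continuous_1) auto
  moreover have "x s = x 0 + integral {0..s} dx" if "s \<in> {0..t}" for s
    using assms that unfolding has_L1_loc_derivative_def atLeastAtMost_iff by blast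
  ultimately show ?thesis
    using continuous_on_cong by (metis (no_types, lifting))
qed

text \<open>
  Over a short interval \<open>b x x\<close> changes by \<open>b (x w + x u)\<close> of the integral of \<open>dx\<close>, and
  \<open>x w + x u\<close> is close to \<open>2 * x s\<close> by uniform continuity. Hence no product rule for
  absolutely continuous functions is needed, nor the measurability of \<open>\<lambda>s. b (x s) (dx s)\<close>.
\<close>

lemma quadratic_form_increment_le:
  fixes b :: "'a::euclidean_space \<Rightarrow> 'a \<Rightarrow> real"
  assumes b: "bilinear b" "\<And>x y. b x y = b y x"
    and x: "has_L1_loc_derivative x dx"
    and t: "0 \<le> a" "a \<le> t"
    and h: "h integrable_on {a..t}"
    and N: "negligible N" "\<And>s. s \<in> {a..t} - N \<Longrightarrow> 2 * b (x s) (dx s) \<le> h s"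
  shows "b (x t) (x t) - b (x a) (x a) \<le> integral {a..t} h"
proof -
  obtain K where K: "K > 0" "\<And>x y. \<bar>b x y\<bar> \<le> K * norm x * norm y"
    using bilinear_bounded_pos[OF b(1)] by (auto simp: mult.commute)
  let ?J = "integral {a..t} (\<lambda>s. norm (dx s))"
  note int = has_L1_loc_derivative_integrable[OF x]
  have main: "b (x t) (x t) - b (x a) (x a) \<le> integral {a..t} h + 2 * K * e * ?J" if "e > 0" for e
  proof -
    have "uniformly_continuous_on {0..t} x"
      by (intro compact_uniformly_continuous has_L1_loc_derivative_continuous[OF x]) auto
    then obtain d where d: "d > 0"
      "\<And>s s'. s \<in> {0..t} \<Longrightarrow> s' \<in> {0..t} \<Longrightarrow> dist s' s < d \<Longrightarrow> dist (x s') (x s) < e"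
      unfolding uniformly_continuous_on_def using \<open>e > 0\<close> by metis
    let ?h = "\<lambda>s. h s + 2 * K * e * norm (dx s)"
    have h_int: "?h integrable_on {u..w}" if "a \<le> u" "w \<le> t" for u w
      using that t
      by (intro integrable_add integrable_on_mult_right int integrable_on_subinterval[OF h]) auto
    have "b (x t) (x t) - b (x a) (x a) \<le> integral {a..t} ?h - integral {a..a} ?h"
    proof (rule increment_le_of_local_increments[OF t(2) d(1)])
      fix u w assume uw: "a \<le> u" "u \<le> w" "w \<le> t" "w - u < d"
      let ?c = "x w + x u"
      have lin: "linear (b y)" "linear (\<lambda>z. b z y)" for y
        using b(1) by (auto simp: bilinear_def)
      have dx: "dx integrable_on {u..w}"
        using uw t by (intro int) auto
      have lin_c: "bounded_linear (b ?c)"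
        using lin(1) by (simp add: linear_linear)
      have "b (x w) (x w) - b (x u) (x u) = b ?c (x w - x u)"
        using b(2)[of "x u" "x w"]
        by (simp add: linear_diff[OF lin(1)] linear_add[OF lin(2)])
      also have "x w - x u = integral {u..w} dx"
        using has_L1_loc_derivative_diff[OF x] uw t by simp
      also have "b ?c (integral {u..w} dx) = integral {u..w} (\<lambda>s. b ?c (dx s))"
        using integral_linear[OF dx lin_c]
        by (simp add: o_def)
      also have "\<dots> \<le> integral {u..w} ?h"
      proof (rule integral_mono_negligible[OF _ _ N(1)])
        show "(\<lambda>s. b ?c (dx s)) integrable_on {u..w}"
          using integrable_linear[OF dx lin_c]
          by (simp add: o_def)
        show "?h integrable_on {u..w}"
          using uw by (intro h_int) auto
        fix s assume s: "s \<in> {u..w} - N"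
        let ?r = "(x w - x s) + (x u - x s)"
        have "norm ?r \<le> dist (x w) (x s) + dist (x u) (x s)"
          unfolding dist_norm by (rule norm_triangle_ineq)
        also have "\<dots> \<le> 2 * e"
          using d(2)[of s w] d(2)[of s u] s uw t by (auto simp: dist_real_def)
        finally have "K * norm ?r * norm (dx s) \<le> K * (2 * e) * norm (dx s)"
          using K(1) by (intro mult_right_mono mult_left_mono) auto
        then have "b ?r (dx s) \<le> 2 * K * e * norm (dx s)"
          using K(2)[of ?r "dx s"] by simp
        moreover have "b ?c (dx s) = 2 * b (x s) (dx s) + b ?r (dx s)"
          by (simp add: linear_diff[OF lin(2)] linear_add[OF lin(2)])
        moreover have "2 * b (x s) (dx s) \<le> h s"
          using s uw by (intro N(2)) auto
        ultimately show "b ?c (dx s) \<le> ?h s"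
          by simp
      qed
      also have "\<dots> = integral {a..w} ?h - integral {a..u} ?h"
        using Henstock_Kurzweil_Integration.integral_combine[of a u w ?h] h_int uw t by simp
      finally show "b (x w) (x w) - b (x u) (x u) \<le> integral {a..w} ?h - integral {a..u} ?h" .
    qed
    also have "\<dots> = integral {a..t} h + 2 * K * e * ?J"
      using h int(2)[of a t] t
      by (simp add: Henstock_Kurzweil_Integration.integral_add integrable_on_mult_right)
    finally show ?thesis .
  qed
  have J: "?J \<ge> 0"
    by (intro integral_nonneg int) (use t in auto)
  show ?thesis
  proof (rule field_le_epsilon)
    fix \<epsilon> :: real assume "\<epsilon> > 0"
    \<comment> \<open>The summand 1 keeps the denominator positive when \<open>?J\<close>
      vanishes.\<close>
    define e where "e = \<epsilon> / (2 * K * (?J + 1))"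
    have "e > 0"
      using \<open>\<epsilon> > 0\<close> K J by (simp add: e_def)
    have "2 * K * e * ?J \<le> 2 * K * e * (?J + 1)"
      using K \<open>e > 0\<close> by (intro mult_left_mono) auto
    also have "\<dots> = \<epsilon>"
      using K J by (simp add: e_def)
    finally show "b (x t) (x t) - b (x a) (x a) \<le> integral {a..t} h + \<epsilon>"
      using main[OF \<open>e > 0\<close>] by linarith
  qed
qed

section \<open>Class KL bounds\<close>

text \<open>
  The supremum of \<open>f \<tau> - 2 * \<kappa> * max 0 (r - s)\<close> over the pairs \<open>(r, f)\<close> and \<open>\<tau> \<ge> t\<close> bounds
  the family and is Lipschitz in \<open>s\<close>. As \<open>f \<tau> \<le> \<kappa> * r\<close>, only pairs with \<open>r \<le> 2 * s\<close>
  contribute a positive value, so that it inherits the decay in \<open>t\<close>. Adding \<open>s / (1 + t)\<close> makes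
  it strictly increasing in \<open>s\<close>.
\<close>

lemma class_KL_bound_exists:
  fixes S :: "(real \<times> (real \<Rightarrow> real)) set"
  assumes "0 \<le> \<kappa>"
    and nonneg: "\<And>r f. (r, f) \<in> S \<Longrightarrow> 0 \<le> r"
    and bound: "\<And>r f t. (r, f) \<in> S \<Longrightarrow> 0 \<le> t \<Longrightarrow> f t \<le> \<kappa> * r"
    and attract: "\<And>R \<epsilon>. 0 < \<epsilon> \<Longrightarrow> \<exists>T. \<forall>(r, f)\<in>S. r \<le> R \<longrightarrow> (\<forall>t\<ge>T. f t \<le> \<epsilon>)"
  shows "\<exists>\<psi>\<in>class_KL. \<forall>(r, f)\<in>S. \<forall>t\<ge>0. f t \<le> \<psi> r t"
proof -
  \<comment> \<open>Inserting 0 keeps the set nonempty and its supremum nonnegative.\<close>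
  define X where
    "X s t = insert 0 {f \<tau> - 2 * \<kappa> * max 0 (r - s) | r f \<tau>. (r, f) \<in> S \<and> t \<le> \<tau>}" for s t
  define \<psi>0 where "\<psi>0 s t = Sup (X s t)" for s t
  define \<psi> where "\<psi> s t = \<psi>0 s t + s / (1 + t)" for s t
  have X_memI: "f \<tau> - 2 * \<kappa> * max 0 (r - s) \<in> X s t" if "(r, f) \<in> S" "t \<le> \<tau>" for r f \<tau> s t
    using that unfolding X_def by auto
  \<comment> \<open>For \<open>s < r\<close> the penalty has slope \<open>2 * \<kappa>\<close>,
    steeper than the growth \<open>\<kappa> * r\<close>, so the value is at most
    \<open>2 * \<kappa> * s - \<kappa> * r\<close>, hence at most
    \<open>\<kappa> * s\<close>.\<close>
  have elem_le_s: "f \<tau> - 2 * \<kappa> * max 0 (r - s) \<le> \<kappa> * s" if "(r, f) \<in> S" "0 \<le> \<tau>" for r f \<tau> s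
  proof (cases "s < r")
    case True
    then have "\<kappa> * s \<le> \<kappa> * r"
      using \<open>0 \<le> \<kappa>\<close> by (intro mult_left_mono) auto
    moreover have "max 0 (r - s) = r - s"
      using True by simp
    moreover have "2 * \<kappa> * (r - s) = 2 * (\<kappa> * r) - 2 * (\<kappa> * s)"
      by (simp add: algebra_simps)
    ultimately show ?thesis
      using bound[OF that] by linarith
  next
    case False
    then have "\<kappa> * r \<le> \<kappa> * s"
      using \<open>0 \<le> \<kappa>\<close> by (intro mult_left_mono) auto
    moreover have "max 0 (r - s) = 0"
      using False by simp
    ultimately show ?thesis
      using bound[OF that] by simp
  qed
  have bdd: "bdd_above (X s t)" if "0 \<le> s" "0 \<le> t" for s t
  proof (rule bdd_aboveI)
    fix z assume "z \<in> X s t"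
    then consider "z = 0" | r f \<tau> where "(r, f) \<in> S" "t \<le> \<tau>" "z = f \<tau> - 2 * \<kappa> * max 0 (r - s)"
      unfolding X_def by blast
    then show "z \<le> \<kappa> * s"
    proof cases
      case 1
      then show ?thesis
        using that \<open>0 \<le> \<kappa>\<close> by simp
    next
      case 2
      then show ?thesis
        using elem_le_s[of r f \<tau> s] that by linarith
    qed
  qed
  have upper: "z \<le> \<psi>0 s t" if "z \<in> X s t" "0 \<le> s" "0 \<le> t" for z s t
    unfolding \<psi>0_def using that bdd by (intro cSup_upper) auto
  have least: "\<psi>0 s t \<le> B" if "0 \<le> B"
    "\<And>r f \<tau>. (r, f) \<in> S \<Longrightarrow> t \<le> \<tau> \<Longrightarrow> f \<tau> - 2 * \<kappa> * max 0 (r - s) \<le> B" for B s t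
    unfolding \<psi>0_def by (rule cSup_least) (auto simp: X_def that(1) intro: that(2))
  have nonneg0: "0 \<le> \<psi>0 s t" if "0 \<le> s" "0 \<le> t" for s t
    by (rule upper[OF _ that]) (simp add: X_def)
  have lip: "\<psi>0 s' t \<le> \<psi>0 s t + 2 * \<kappa> * max 0 (s' - s)"
    if "0 \<le> s" "0 \<le> s'" "0 \<le> t" for s s' t
  proof (rule least)
    show "0 \<le> \<psi>0 s t + 2 * \<kappa> * max 0 (s' - s)"
      using nonneg0[of s t] that \<open>0 \<le> \<kappa>\<close> by (intro add_nonneg_nonneg mult_nonneg_nonneg) auto
    fix r f \<tau> assume *: "(r, f) \<in> S" "t \<le> \<tau>"
    have "2 * \<kappa> * max 0 (r - s) \<le> 2 * \<kappa> * (max 0 (r - s') + max 0 (s' - s))"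
      using \<open>0 \<le> \<kappa>\<close> by (intro mult_left_mono) auto
    then show "f \<tau> - 2 * \<kappa> * max 0 (r - s') \<le> \<psi>0 s t + 2 * \<kappa> * max 0 (s' - s)"
      using upper[OF X_memI[OF *] that(1,3)] by (simp add: distrib_left)
  qed
  have "(\<lambda>s. \<psi> s t) \<in> class_K" if "0 \<le> t" for t
  proof -
    have mono: "\<psi>0 s t \<le> \<psi>0 s' t" if "0 \<le> s" "s \<le> s'" for s s'
      using lip[of s' s t] that \<open>0 \<le> t\<close> by (simp add: max_absorb1)
    have "(2 * \<kappa>)-lipschitz_on {0..} (\<lambda>s. \<psi>0 s t)"
    proof (rule lipschitz_onI)
      fix s s' :: real assume "s \<in> {0..}" "s' \<in> {0..}"
      then show "dist (\<psi>0 s t) (\<psi>0 s' t) \<le> 2 * \<kappa> * dist s s'"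
        using lip[of s s' t] lip[of s' s t] mono[of s s'] mono[of s' s] \<open>0 \<le> t\<close>
        by (cases "s \<le> s'") (auto simp: dist_real_def max_absorb1 max_absorb2)
    qed (use \<open>0 \<le> \<kappa>\<close> in simp)
    then have "continuous_on {0..} (\<lambda>s. \<psi> s t)"
      unfolding \<psi>_def using \<open>0 \<le> t\<close>
      by (intro continuous_intros) (auto dest: lipschitz_on_continuous_on)
    moreover have "\<psi>0 0 t \<le> 0"
      by (rule least) (use elem_le_s[of _ _ _ 0] \<open>0 \<le> t\<close> in auto)
    then have "\<psi> 0 t = 0"
      using nonneg0[of 0 t] \<open>0 \<le> t\<close> by (simp add: \<psi>_def)
    moreover have "\<psi> s t > 0" if "s > 0" for s
      unfolding \<psi>_def using that \<open>0 \<le> t\<close> nonneg0[of s t] by (intro add_nonneg_pos) auto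
    moreover have "strict_mono_on {0..} (\<lambda>s. \<psi> s t)"
      unfolding \<psi>_def using \<open>0 \<le> t\<close>
      by (intro strict_mono_onI add_le_less_mono mono divide_strict_right_mono) auto
    ultimately show ?thesis
      by (simp add: class_K_def class_P_def)
  qed
  moreover have "antimono_on {0..} (\<psi> s)" if "0 \<le> s" for s
  proof (rule monotone_onI)
    fix t t' :: real assume t: "t \<in> {0..}" "t' \<in> {0..}" "t \<le> t'"
    then have "\<psi>0 s t' \<le> \<psi>0 s t"
      by (intro least nonneg0 upper X_memI \<open>0 \<le> s\<close>) auto
    moreover have "s / (1 + t') \<le> s / (1 + t)"
      using t \<open>0 \<le> s\<close> by (intro divide_left_mono) auto
    ultimately show "\<psi> s t' \<le> \<psi> s t"
      by (simp add: \<psi>_def)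
  qed
  moreover have "(\<psi> s \<longlongrightarrow> 0) at_top" if "0 \<le> s" for s
  proof -
    have "(\<psi>0 s \<longlongrightarrow> 0) at_top"
    proof (rule tendstoI)
      fix \<epsilon> :: real assume "\<epsilon> > 0"
      then obtain T where T: "\<And>r f t. (r, f) \<in> S \<Longrightarrow> r \<le> 2 * s \<Longrightarrow> t \<ge> T \<Longrightarrow> f t \<le> \<epsilon> / 2"
        using attract[of "\<epsilon> / 2" "2 * s"] by fastforce
      \<comment> \<open>\<open>T\<close> may be negative, whereas \<open>bound\<close> speaks of
        nonnegative times.\<close>
      have "\<psi>0 s t \<le> \<epsilon> / 2" if "t \<ge> max 0 T" for t
      proof (rule least)
        fix r f \<tau> assume *: "(r, f) \<in> S" "t \<le> \<tau>"
        show "f \<tau> - 2 * \<kappa> * max 0 (r - s) \<le> \<epsilon> / 2"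
        proof (cases "r \<le> 2 * s")
          case True
          have "0 \<le> 2 * \<kappa> * max 0 (r - s)"
            using \<open>0 \<le> \<kappa>\<close> by simp
          then show ?thesis
            using T[OF *(1) True, of \<tau>] * that by simp
        next
          case False
          then have "\<kappa> * (2 * s) \<le> \<kappa> * r"
            using \<open>0 \<le> \<kappa>\<close> by (intro mult_left_mono) auto
          moreover have "max 0 (r - s) = r - s"
            using False \<open>0 \<le> s\<close> by simp
          moreover have "2 * \<kappa> * (r - s) = 2 * (\<kappa> * r) - \<kappa> * (2 * s)"
            by (simp add: algebra_simps)
          moreover have "f \<tau> \<le> \<kappa> * r"
            using bound[OF *(1), of \<tau>] * that by simp
          ultimately have "f \<tau> - 2 * \<kappa> * max 0 (r - s) \<le> 0"
            by simp
          with \<open>\<epsilon> > 0\<close> show ?thesis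
            by simp
        qed
      qed (use \<open>\<epsilon> > 0\<close> in simp)
      then show "\<forall>\<^sub>F t in at_top. dist (\<psi>0 s t) 0 < \<epsilon>"
        using nonneg0[OF \<open>0 \<le> s\<close>] \<open>\<epsilon> > 0\<close>
        by (intro eventually_mono[OF eventually_ge_at_top[of "max 0 T"]]) fastforce
    qed
    moreover have "((\<lambda>t. s / (1 + t)) \<longlongrightarrow> 0) at_top"
      by (intro tendsto_divide_0[OF tendsto_const] filterlim_at_top_imp_at_infinity
          filterlim_tendsto_add_at_top[OF tendsto_const] filterlim_ident)
    ultimately show ?thesis
      unfolding \<psi>_def[abs_def] by (auto intro: tendsto_add_zero)
  qed
  moreover have "f t \<le> \<psi> r t" if "(r, f) \<in> S" "0 \<le> t" for r f t
    using upper[OF X_memI[OF that(1), of t t r]] nonneg[OF that(1)] that(2)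
    by (simp add: \<psi>_def add_increasing2)
  ultimately show ?thesis
    by (intro bexI[of _ \<psi>]) (auto simp: class_KL_def)
qed

section \<open>Passivity and elementary estimates\<close>

lemma sum_UNIV_Plus:
  fixes f :: "'a::finite + 'b::finite \<Rightarrow> 'c::comm_monoid_add"
  shows "sum f UNIV = (\<Sum>a\<in>UNIV. f (Inl a)) + (\<Sum>b\<in>UNIV. f (Inr b))"
  using sum.Plus[of "UNIV :: 'a set" "UNIV :: 'b set" f] by (simp add: o_def)

lemma inner_block_matrix:
  fixes x :: "real^'n" and u :: "real^'m"
  defines "z \<equiv> (\<chi> i. case i of Inl a \<Rightarrow> x $ a | Inr b \<Rightarrow> u $ b)"
  shows "z \<bullet> (block_matrix K L M N *v z) =
    x \<bullet> (K *v x) + x \<bullet> (L *v u) + u \<bullet> (M *v x) + u \<bullet> (N *v u)"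
  by (simp add: z_def block_matrix_def inner_vec_def matrix_vector_mult_def sum_UNIV_Plus
      distrib_left sum.distrib)

lemma inner_transpose_matrix_vector:
  fixes A :: "real^'n^'m"
  shows "x \<bullet> (transpose A *v y) = (A *v x) \<bullet> y"
  by (metis dot_lmul_matrix inner_commute transpose_matrix_vector)

text \<open>As the lower right block is 0, the quadratic form at the stacked vector of
  \<open>x\<close> and \<open>u\<close> is affine in \<open>u\<close>. An affine function that is
  bounded above has no linear part.\<close>

lemma passivity_of_block_matrix:
  fixes A :: "real^'n^'n" and B :: "real^'m^'n" and C :: "real^'n^'m"
  assumes P: "transpose P = P"
    and neg: "neg_semidefinite
             (block_matrix (transpose A ** P + P ** A) (P ** B - transpose C)
                           (transpose B ** P - C) 0)"
  shows "x \<bullet> (P *v (A *v x)) \<le> 0" "x \<bullet> (P *v (B *v u)) = (C *v x) \<bullet> u"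
proof -
  define \<beta> where "\<beta> u = x \<bullet> (P *v (B *v u)) - (C *v x) \<bullet> u" for u
  have sym: "y \<bullet> (P *v z) = (P *v y) \<bullet> z" for y z
    using inner_transpose_matrix_vector[of y P z] P by simp
  have form: "2 * (x \<bullet> (P *v (A *v x))) + 2 * \<beta> u \<le> 0" for u
  proof -
    have "x \<bullet> ((transpose A ** P + P ** A) *v x) = 2 * (x \<bullet> (P *v (A *v x)))"
      by (simp add: matrix_vector_mult_add_rdistrib inner_add_right matrix_vector_mul_assoc[symmetric]
          inner_transpose_matrix_vector sym[of x] inner_commute
          del: transpose_matrix_vector)
    moreover have "x \<bullet> ((P ** B - transpose C) *v u) = \<beta> u"
      by (simp add: \<beta>_def matrix_vector_mult_diff_rdistrib inner_diff_right
          matrix_vector_mul_assoc[symmetric] inner_transpose_matrix_vector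
          del: transpose_matrix_vector)
    moreover have "u \<bullet> ((transpose B ** P - C) *v x) = \<beta> u"
    proof -
      have "u \<bullet> (transpose B *v (P *v x)) = x \<bullet> (P *v (B *v u))"
        unfolding inner_transpose_matrix_vector sym[of x] by (rule inner_commute)
      then show ?thesis
        by (simp add: \<beta>_def matrix_vector_mult_diff_rdistrib inner_diff_right
            matrix_vector_mul_assoc[symmetric] inner_commute[of u "C *v x"]
            del: transpose_matrix_vector)
    qed
    moreover have "x \<bullet> ((transpose A ** P + P ** A) *v x) + x \<bullet> ((P ** B - transpose C) *v u) +
        u \<bullet> ((transpose B ** P - C) *v x) + u \<bullet> (0 *v u) \<le> 0"
      using neg unfolding neg_semidefinite_def inner_block_matrix[symmetric] by blast
    ultimately show ?thesis
      by simp
  qed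
  have \<beta>_scale: "\<beta> (r *\<^sub>R u) = r * \<beta> u" for r
    by (simp add: \<beta>_def matrix_vector_mult_scaleR right_diff_distrib)
  from form[of 0] show neg_A: "x \<bullet> (P *v (A *v x)) \<le> 0"
    by (simp add: \<beta>_def)
  have "\<beta> u = 0"
  proof (rule ccontr)
    assume "\<beta> u \<noteq> 0"
    \<comment> \<open>For this multiple of \<open>u\<close> the form takes the value 2.\<close>
    then show False
      using form[of "((1 - x \<bullet> (P *v (A *v x))) / \<beta> u) *\<^sub>R u"] by (simp add: \<beta>_scale)
  qed
  then show "x \<bullet> (P *v (B *v u)) = (C *v x) \<bullet> u"
    by (simp add: \<beta>_def)
qed

text \<open>The constant is the square root of the minimum of the form on the unit sphere;
  homogeneity does the rest.\<close>

lemma pos_definite_coercive: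
  fixes P :: "real^'n^'n"
  assumes "pos_definite P"
  shows "\<exists>p>0. \<forall>x. p * norm x \<le> sqrt (x \<bullet> (P *v x))"
proof -
  have "continuous_on (sphere 0 1) (\<lambda>x. x \<bullet> (P *v x))"
    by (intro continuous_intros linear_continuous_on linear_linear[THEN iffD2]) simp
  moreover have "sphere (0::real^'n) 1 \<noteq> {}"
    using sphere_eq_empty[of "0::real^'n" 1] by simp
  ultimately obtain e where e: "norm e = 1" "\<And>x. norm x = 1 \<Longrightarrow> e \<bullet> (P *v e) \<le> x \<bullet> (P *v x)"
    using continuous_attains_inf[of "sphere (0::real^'n) 1" "\<lambda>x. x \<bullet> (P *v x)"] by fastforce
  define m where "m = e \<bullet> (P *v e)"
  have "m > 0"
    using assms e(1) unfolding pos_definite_def m_def by (metis norm_zero zero_neq_one)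
  have "m * (norm x)\<^sup>2 \<le> x \<bullet> (P *v x)" for x
  proof (cases "x = 0")
    case False
    let ?s = "x /\<^sub>R norm x"
    have "m \<le> ?s \<bullet> (P *v ?s)"
      unfolding m_def using False by (intro e(2)) simp
    also have "?s \<bullet> (P *v ?s) = (x \<bullet> (P *v x)) / (norm x)\<^sup>2"
      by (simp add: matrix_vector_mult_scaleR power2_eq_square field_simps)
    finally show ?thesis
      using False by (simp add: field_simps)
  qed simp
  then have "sqrt (m * (norm x)\<^sup>2) \<le> sqrt (x \<bullet> (P *v x))" for x
    by (rule real_sqrt_le_mono)
  then show ?thesis
    using \<open>m > 0\<close> by (intro exI[of _ "sqrt m"]) (simp add: real_sqrt_mult)
qed

text \<open>The set where \<open>g \<ge> \<rho>\<close> is compact and avoids 0, so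
  \<open>g / h\<close> is bounded there; elsewhere \<open>\<rho>\<close> alone suffices.\<close>

lemma le_epsilon_plus_multiple:
  fixes g h :: "real \<Rightarrow> real"
  assumes g: "continuous_on {0..R} g" "g 0 = 0"
    and h: "continuous_on {0..R} h" "h 0 \<ge> 0" "\<And>s. 0 < s \<Longrightarrow> s \<le> R \<Longrightarrow> 0 < h s"
    and "0 < \<rho>"
  shows "\<exists>k\<ge>0. \<forall>s\<in>{0..R}. g s \<le> \<rho> + k * h s"
proof -
  define X where "X = {0..R} \<inter> g -` {\<rho>..}"
  have "closed X"
    unfolding X_def using g(1) by (rule continuous_closed_preimage) auto
  moreover have "bounded X"
    unfolding X_def by (rule bounded_subset[of "{0..R}"]) auto
  ultimately have "compact X"
    by (simp add: compact_eq_bounded_closed)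
  have hX: "0 < h s" if "s \<in> X" for s
    using that g(2) \<open>0 < \<rho>\<close> by (intro h) (auto simp: X_def less_le)
  have "continuous_on X (\<lambda>s. g s / h s)"
    using hX by (intro continuous_intros continuous_on_subset[OF g(1)] continuous_on_subset[OF h(1)])
      (auto simp: X_def, fastforce)
  then have "bounded ((\<lambda>s. g s / h s) ` X)"
    using \<open>compact X\<close> by (intro compact_imp_bounded compact_continuous_image)
  then obtain k where k: "\<And>s. s \<in> X \<Longrightarrow> \<bar>g s / h s\<bar> \<le> k"
    by (auto simp: bounded_iff)
  \<comment> \<open>The bound \<open>k\<close> may be negative if \<open>X\<close> is empty.\<close>
  have "g s \<le> \<rho> + \<bar>k\<bar> * h s" if "s \<in> {0..R}" for s
  proof (cases "s \<in> X")
    case True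
    then have "g s / h s \<le> \<bar>k\<bar>"
      using k[OF True] by linarith
    then show ?thesis
      using hX[OF True] \<open>0 < \<rho>\<close> by (simp add: field_simps)
  next
    case False
    have "0 \<le> h s"
      using h(2) h(3)[of s] that by (cases "s = 0") (auto simp: less_le)
    then show ?thesis
      using False that by (simp add: X_def add_increasing2)
  qed
  then show ?thesis
    by (intro exI[of _ "\<bar>k\<bar>"]) auto
qed

text \<open>
  Applied with \<open>M\<close> the maximum of \<open>N\<close>: this replaces the differentiation of the square root of
  a storage function, which may vanish.
\<close>

lemma le_of_square_le_max:
  fixes N :: "real \<Rightarrow> real"
  assumes "a \<le> t" "continuous_on {a..t} N" "\<And>s. 0 \<le> N s"
    and "\<And>s M. a \<le> s \<Longrightarrow> s \<le> t \<Longrightarrow> (\<And>r. r \<in> {a..s} \<Longrightarrow> N r \<le> M) \<Longrightarrow> (N s)\<^sup>2 \<le> (N a)\<^sup>2 + M * d"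
    and "0 \<le> d"
  shows "N t \<le> N a + d"
proof -
  obtain s where s: "s \<in> {a..t}" "\<And>r. r \<in> {a..t} \<Longrightarrow> N r \<le> N s"
    using continuous_attains_sup[of "{a..t}" N] assms(1,2) by auto
  have "N s \<le> N a + d"
  proof (cases "N s = 0")
    case False
    have "N s * N s \<le> N a * N a + N s * d"
      using assms(4)[of s "N s"] s by (auto simp: power2_eq_square)
    also have "\<dots> \<le> N s * N a + N s * d"
      using s(2)[of a] assms(1,3) by (intro add_right_mono mult_right_mono) auto
    finally have "N s * N s \<le> N s * (N a + d)"
      by (simp add: distrib_left)
    moreover have "0 < N s"
      using False assms(3)[of s] by simp
    ultimately show ?thesis
      by simp
  qed (use assms in auto)
  then show ?thesis
    using s(2)[of t] assms(1) by simp
qed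

section \<open>The passive Lur'e system\<close>

text \<open>The element \<open>w\<close> is selected separately at each time, with no claim of
  measurability; the pointwise inequality in \<open>quadratic_form_increment_le\<close> asks for no
  more.\<close>

lemma B_incE:
  assumes "(v, x) \<in> B_inc A B C F"
  obtains dx N where "v \<in> L1_loc" "has_L1_loc_derivative x dx" "negligible N"
    "\<And>s. 0 \<le> s \<Longrightarrow> s \<notin> N \<Longrightarrow> \<exists>w\<in>F (C *v x s). dx s = A *v x s + B *v v s - B *v w"
proof -
  obtain dx where dx: "v \<in> L1_loc" "has_L1_loc_derivative x dx"
    "AE t in lebesgue. t \<ge> 0 \<longrightarrow> dx t - A *v x t - B *v v t \<in> (\<lambda>w. - (B *v w)) ` F (C *v x t)"
    using assms unfolding B_inc_def by blast
  then obtain N where N: "N \<in> null_sets lebesgue"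
    "{t. \<not> (t \<ge> 0 \<longrightarrow> dx t - A *v x t - B *v v t \<in> (\<lambda>w. - (B *v w)) ` F (C *v x t))} \<subseteq> N"
    unfolding eventually_ae_filter by auto
  have "\<exists>w\<in>F (C *v x s). dx s = A *v x s + B *v v s - B *v w" if "0 \<le> s" "s \<notin> N" for s
  proof -
    have "dx s - A *v x s - B *v v s \<in> (\<lambda>w. - (B *v w)) ` F (C *v x s)"
      using N(2) that by blast
    then obtain w where "w \<in> F (C *v x s)" "dx s - A *v x s - B *v v s = - (B *v w)"
      by blast
    then show ?thesis
      by (intro bexI[of _ w]) (simp_all add: algebra_simps)
  qed
  with dx(1,2) N(1) show ?thesis
    by (intro that[of dx N]) (simp_all add: negligible_iff_null_sets)
qed

text \<open>The matrix inequality enters as \<open>dissipative\<close> and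
  \<open>collocated\<close>, detectability as the form \<open>b\<close> with \<open>b_decay\<close>.
  The constants \<open>p\<close> and \<open>q\<close> compare the norm given by \<open>P\<close>
  with the Euclidean one, and \<open>c\<close> bounds the output by it.\<close>

locale passive_lure_system =
  fixes A :: "real^'n^'n" and B :: "real^'m^'n" and C :: "real^'n^'m"
    and \<theta> \<alpha> :: "real \<Rightarrow> real" and P :: "real^'n^'n" and H :: "real^'m^'n"
    and b :: "real^'n \<Rightarrow> real^'n \<Rightarrow> real" and p q c :: real
  assumes \<theta>: "continuous_on {0..} \<theta>" "\<theta> 0 = 0"
    and \<alpha>: "continuous_on {0..} \<alpha>" "\<alpha> 0 = 0" "\<And>s. 0 < s \<Longrightarrow> 0 < \<alpha> s"
    and P_sym: "transpose P = P"
    and dissipative: "\<And>x. x \<bullet> (P *v (A *v x)) \<le> 0"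
    and collocated: "\<And>x u. x \<bullet> (P *v (B *v u)) = (C *v x) \<bullet> u"
    and b: "bilinear b" "\<And>x y. b x y = b y x" "\<And>x. 0 \<le> b x x"
    and b_decay: "\<And>x. 2 * b x ((A - H ** C) *v x) \<le> - (norm x)\<^sup>2"
    and p: "0 < p" "\<And>x. p * norm x \<le> sqrt (x \<bullet> (P *v x))"
    and q: "0 < q" "\<And>x. sqrt (x \<bullet> (P *v x)) \<le> q * norm x"
    and c: "0 < c" "\<And>x. norm (C *v x) \<le> c * sqrt (x \<bullet> (P *v x))"
begin

abbreviation "stor x y \<equiv> x \<bullet> (P *v y)"
abbreviation "nrm x \<equiv> sqrt (stor x x)"

lemma stor_bilinear: "bilinear stor"
  by (simp add: bilinear_def linear_iff inner_add_left inner_add_right matrix_vector_right_distrib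
      matrix_vector_mult_scaleR)

lemma stor_sym: "stor x y = stor y x"
  using inner_transpose_matrix_vector[of x P y] P_sym by (simp add: inner_commute)

text \<open>Since \<open>sqrt\<close> is negative at negative arguments, coercivity is what gives
  the sign, and then that of \<open>stor x x\<close>.\<close>

lemma nrm_nonneg: "0 \<le> nrm x"
  using p(2)[of x] p(1) by (meson mult_nonneg_nonneg less_imp_le norm_ge_zero order_trans)

lemma stor_nonneg: "0 \<le> stor x x"
  using nrm_nonneg[of x] by simp

lemma \<alpha>_nonneg: "0 \<le> s \<Longrightarrow> 0 \<le> \<alpha> s"
  using \<alpha>(2,3) by (metis less_eq_real_def)

text \<open>By \<open>collocated\<close>, both \<open>B\<close> terms become pairings with the
  output; the sector condition in \<open>F0\<close> turns the one with \<open>w\<close> into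
  dissipation.\<close>

lemma storage_rate:
  assumes "w \<in> F0 \<theta> \<alpha> (C *v x)"
  shows "stor x (A *v x + B *v u - B *v w) \<le>
    norm (C *v x) * norm u - norm (C *v x) * \<alpha> (norm (C *v x))"
proof -
  have "stor x (A *v x + B *v u - B *v w) = stor x (A *v x) + (C *v x) \<bullet> u - (C *v x) \<bullet> w"
    by (simp add: matrix_vector_right_distrib matrix_vector_mult_diff_distrib inner_add_right
        inner_diff_right collocated)
  also have "\<dots> \<le> 0 + norm (C *v x) * norm u - norm (C *v x) * \<alpha> (norm (C *v x))"
    using assms
    by (intro diff_mono add_mono dissipative norm_cauchy_schwarz) (simp add: F0_def inner_commute)
  finally show ?thesis
    by simp
qed

lemma input_integrable:
  assumes "v \<in> L1_loc" "0 \<le> a"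
  shows "(\<lambda>s. norm (v s)) integrable_on {a..t}"
proof -
  have "(\<lambda>s. norm (v s)) integrable_on {0..max 0 t}"
    using assms(1) by (simp add: L1_loc_def absolutely_integrable_on_def)
  then show ?thesis
    using assms(2) by (auto elim!: integrable_on_subinterval)
qed

text \<open>Formally, \<open>nrm (x t)\<close> has derivative at most \<open>c * norm (v t)\<close>.
  Bounding it by its maximum in the estimate of its square, instead of differentiating, costs the
  factor 2.\<close>

lemma nrm_growth:
  assumes vx: "(v, x) \<in> B_inc A B C (F0 \<theta> \<alpha>)" and t: "0 \<le> a" "a \<le> t"
  shows "nrm (x t) \<le> nrm (x a) + 2 * c * integral {a..t} (\<lambda>s. norm (v s))"
proof -
  obtain dx N where v: "v \<in> L1_loc" and x: "has_L1_loc_derivative x dx"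
    and N: "negligible N"
      "\<And>s. 0 \<le> s \<Longrightarrow> s \<notin> N \<Longrightarrow>
         \<exists>w\<in>F0 \<theta> \<alpha> (C *v x s). dx s = A *v x s + B *v v s - B *v w"
    using B_incE[OF vx] by blast
  note int = input_integrable[OF v]
  have int_nonneg: "0 \<le> integral {u..w} (\<lambda>s. norm (v s))" if "0 \<le> u" for u w
    by (intro integral_nonneg int that) auto
  show ?thesis
  proof (rule le_of_square_le_max[OF t(2)])
    have "continuous_on {a..t} x"
      by (rule continuous_on_subset[OF has_L1_loc_derivative_continuous[OF x, of t]]) (use t in auto)
    then show "continuous_on {a..t} (\<lambda>s. nrm (x s))"
      by (intro continuous_intros bounded_linear.continuous_on[of "(*v) P"])
         (auto simp: linear_linear[symmetric])
    show "0 \<le> 2 * c * integral {a..t} (\<lambda>s. norm (v s))"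
      using c int_nonneg[OF t(1)] by simp
    fix s M assume s: "a \<le> s" "s \<le> t" and M: "\<And>r. r \<in> {a..s} \<Longrightarrow> nrm (x r) \<le> M"
    have "0 \<le> M"
      using order_trans[OF nrm_nonneg M[of a]] s by simp
    have "stor (x s) (x s) - stor (x a) (x a) \<le> integral {a..s} (\<lambda>r. 2 * c * M * norm (v r))"
    proof (rule quadratic_form_increment_le[OF stor_bilinear stor_sym x t(1) s(1) _ N(1)])
      show "(\<lambda>r. 2 * c * M * norm (v r)) integrable_on {a..s}"
        by (intro integrable_on_mult_right int t)
      fix r assume r: "r \<in> {a..s} - N"
      then obtain w where w: "w \<in> F0 \<theta> \<alpha> (C *v x r)" "dx r = A *v x r + B *v v r - B *v w"
        using N(2)[of r] t by auto
      have "0 \<le> norm (C *v x r) * \<alpha> (norm (C *v x r))"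
        by (intro mult_nonneg_nonneg \<alpha>_nonneg) auto
      then have "stor (x r) (dx r) \<le> norm (C *v x r) * norm (v r)"
        using storage_rate[OF w(1), of "v r"] by (simp add: w(2))
      also have "\<dots> \<le> (c * M) * norm (v r)"
        using c(1) r by (intro mult_right_mono order_trans[OF c(2) mult_left_mono] M) auto
      finally show "2 * stor (x r) (dx r) \<le> 2 * c * M * norm (v r)"
        by simp
    qed
    also have "\<dots> = M * (2 * c * integral {a..s} (\<lambda>r. norm (v r)))"
      by (simp add: mult_ac)
    also have "\<dots> \<le> M * (2 * c * integral {a..t} (\<lambda>r. norm (v r)))"
      using \<open>0 \<le> M\<close> c(1) s t
      by (intro mult_left_mono integral_subset_le int) auto
    finally show "(nrm (x s))\<^sup>2 \<le> (nrm (x a))\<^sup>2 + M * (2 * c * integral {a..t} (\<lambda>s. norm (v s)))"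
      by (simp add: stor_nonneg)
  qed (rule nrm_nonneg)
qed

text \<open>
  If the input is small compared with the initial value, the state stays in a fixed compact set.
  There \<open>b + (\<Lambda> / 2) * stor\<close>, with \<open>\<Lambda>\<close> large, decreases at a fixed rate as long as the state
  is not small: detectability controls the state by the output \<open>y = C *v x\<close>, and the passive
  dissipation \<open>norm y * \<alpha> (norm y)\<close> dominates what the output contributes.
\<close>

lemma uniform_attractivity:
  assumes "0 \<le> R" "0 < \<epsilon>"
  shows "\<exists>T\<ge>0. \<forall>(v, x)\<in>B_inc A B C (F0 \<theta> \<alpha>). nrm (x 0) \<le> R \<longrightarrow>
    (\<forall>t\<ge>T. nrm (x t) \<le> \<epsilon> + (1 + 2 * c) * integral {0..t} (\<lambda>s. norm (v s)))"
proof -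
  \<comment> \<open>While the input integral is at most \<open>R\<close>, growth keeps
    \<open>nrm\<close> below \<open>R1\<close> and the Euclidean norm below \<open>R2\<close>. While
    \<open>nrm\<close> is at least \<open>\<epsilon>\<close>, the squared Euclidean norm is at least
    \<open>\<eta>\<close>.\<close>
  define R1 where "R1 = (1 + 2 * c) * R"
  define R2 where "R2 = R1 / p"
  define \<eta> where "\<eta> = (\<epsilon> / q)\<^sup>2"
  have R: "0 \<le> R1" "0 \<le> R2" and "0 < \<eta>"
    using assms c(1) p(1) q(1) by (simp_all add: R1_def R2_def \<eta>_def)
  obtain Kb where Kb: "0 < Kb" "\<And>x y. \<bar>b x y\<bar> \<le> Kb * norm x * norm y"
    using bilinear_bounded_pos[OF b(1)] by (auto simp: mult.commute)
  obtain KH where KH: "0 < KH" "\<And>y. norm (H *v y) \<le> KH * norm y"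
    using linear_bounded_pos[of "(*v) H"] by (auto simp: mult.commute)
  obtain KB where KB: "0 < KB" "\<And>u. norm (B *v u) \<le> KB * norm u"
    using linear_bounded_pos[of "(*v) B"] by (auto simp: mult.commute)
  define k where "k = 2 * Kb * (KH + KB)"
  have "0 < k"
    using Kb KH KB by (simp add: k_def)
  have k: "2 * b x (H *v y + B *v u) \<le> k * norm x * (norm y + norm u)" for x y u
  proof -
    have "norm (H *v y + B *v u) \<le> KH * norm y + KB * norm u"
      using norm_triangle_ineq[of "H *v y" "B *v u"] KH(2)[of y] KB(2)[of u] by linarith
    also have "\<dots> \<le> (KH + KB) * (norm y + norm u)"
      using KH(1) KB(1) by (simp add: algebra_simps)
    finally have "Kb * norm x * norm (H *v y + B *v u) \<le>
        Kb * norm x * ((KH + KB) * (norm y + norm u))"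
      using Kb(1) by (intro mult_left_mono) auto
    moreover have "k * norm x * (norm y + norm u) =
        2 * (Kb * norm x * ((KH + KB) * (norm y + norm u)))"
      by (simp only: k_def mult_ac)
    ultimately show ?thesis
      using Kb(2)[of x "H *v y + B *v u"] by linarith
  qed
  \<comment> \<open>The tolerance is chosen so that \<open>k * R2\<close> times it is at most
    \<open>\<eta> / 2\<close>; the summand 1 covers \<open>R = 0\<close>.\<close>
  obtain l where "0 \<le> l" and l: "\<And>s. s \<in> {0..c * R1} \<Longrightarrow>
      s + \<theta> s \<le> \<eta> / (2 * (k * R2 + 1)) + l * (s * \<alpha> s)"
  proof -
    have "0 < \<eta> / (2 * (k * R2 + 1))"
      using \<open>0 < \<eta>\<close> \<open>0 < k\<close> R(2) by (intro divide_pos_pos) (auto intro: add_nonneg_pos)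
    moreover have "continuous_on {0..c * R1} \<theta>" "continuous_on {0..c * R1} \<alpha>"
      by (rule continuous_on_subset[OF \<theta>(1)], simp) (rule continuous_on_subset[OF \<alpha>(1)], simp)
    then have "continuous_on {0..c * R1} (\<lambda>s. s + \<theta> s)" "continuous_on {0..c * R1} (\<lambda>s. s * \<alpha> s)"
      by (auto intro!: continuous_intros)
    ultimately have "\<exists>l\<ge>0. \<forall>s\<in>{0..c * R1}. s + \<theta> s \<le> \<eta> / (2 * (k * R2 + 1)) + l * (s * \<alpha> s)"
      using \<theta>(2) \<alpha>(3) by (intro le_epsilon_plus_multiple) simp_all
    then show ?thesis
      using that by blast
  qed
  \<comment> \<open>With this weight the storage dissipation cancels the output terms in the
    derivative of \<open>b\<close>; \<open>M\<close> collects the coefficients of the input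
    norm.\<close>
  define \<Lambda> where "\<Lambda> = k * R2 * l"
  define M where "M = k * R2 + \<Lambda> * c * R1"
  have nn: "0 \<le> \<Lambda>" "0 \<le> M"
    using \<open>0 \<le> l\<close> \<open>0 < k\<close> R c(1) by (simp_all add: \<Lambda>_def M_def)
  have y_bound: "k * R2 * (s + \<theta> s) \<le> \<eta> / 2 + \<Lambda> * (s * \<alpha> s)" if "s \<in> {0..c * R1}" for s
  proof -
    have "0 \<le> k * R2"
      using \<open>0 < k\<close> R by simp
    then have "k * R2 * (s + \<theta> s) \<le> k * R2 * (\<eta> / (2 * (k * R2 + 1)) + l * (s * \<alpha> s))"
      by (intro mult_left_mono l that)
    also have "\<dots> = \<eta> * (k * R2) / (2 * (k * R2 + 1)) + \<Lambda> * (s * \<alpha> s)"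
      by (simp add: \<Lambda>_def distrib_left mult_ac)
    also have "\<eta> * (k * R2) / (2 * (k * R2 + 1)) \<le> \<eta> / 2"
      using \<open>0 \<le> k * R2\<close> \<open>0 < \<eta>\<close> by (simp add: field_simps)
    finally show ?thesis
      by simp
  qed
  define S where "S x y = b x y + (\<Lambda> / 2) * stor x y" for x y
  have S: "bilinear S" "S x y = S y x" "0 \<le> S x x" for x y
    unfolding S_def[abs_def]
    by (intro bilinear_add bilinear_cmult b(1) stor_bilinear)
       (use b nn stor_nonneg stor_sym in \<open>auto intro!: add_nonneg_nonneg mult_nonneg_nonneg\<close>)
  obtain KS where KS: "0 < KS" "\<And>x y. \<bar>S x y\<bar> \<le> KS * norm x * norm y"
    using bilinear_bounded_pos[OF S(1)] by (auto simp: mult.commute)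
  have rate: "2 * S x (A *v x + B *v u - B *v w) \<le> - \<eta> / 2 + M * norm u"
    if x: "nrm x \<le> R1" "\<epsilon> \<le> nrm x" and w: "w \<in> F0 \<theta> \<alpha> (C *v x)" for x u w
  proof -
    let ?y = "C *v x"
    have "p * norm x \<le> R1" "\<epsilon> \<le> q * norm x"
      using x p(2)[of x] q(2)[of x] by linarith+
    then have nx: "norm x \<le> R2" "\<epsilon> / q \<le> norm x"
      using p(1) q(1) by (simp_all add: R2_def field_simps)
    have ny: "norm ?y \<le> c * R1"
      using c(2)[of x] mult_left_mono[OF x(1), of c] c(1) by linarith
    have "\<eta> \<le> (norm x)\<^sup>2"
      unfolding \<eta>_def using nx(2) assms q(1) by (intro power_mono) auto
    \<comment> \<open>Output injection: \<open>H *v ?y\<close> is added and subtracted, and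
      \<open>u - w\<close> acts as a single input of norm at most
      \<open>norm u + \<theta> (norm ?y)\<close>.\<close>
    have "A *v x + B *v u - B *v w = (A - H ** C) *v x + (H *v ?y + B *v (u - w))"
      by (simp add: matrix_vector_mult_diff_rdistrib matrix_vector_mult_diff_distrib
          matrix_vector_mul_assoc)
    then have "2 * b x (A *v x + B *v u - B *v w) =
        2 * b x ((A - H ** C) *v x) + 2 * b x (H *v ?y + B *v (u - w))"
      by (simp add: bilinear_radd[OF b(1)])
    also have "\<dots> \<le> - \<eta> + k * norm x * (norm ?y + norm (u - w))"
      using b_decay[of x] k[of x ?y "u - w"] \<open>\<eta> \<le> (norm x)\<^sup>2\<close> by linarith
    also have "k * norm x * (norm ?y + norm (u - w)) \<le>
        k * R2 * (norm ?y + (norm u + \<theta> (norm ?y)))"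
      using w \<open>0 < k\<close> R nx(1) norm_triangle_ineq4[of u w]
      by (intro mult_mono) (auto simp: F0_def)
    also have "\<dots> = k * R2 * (norm ?y + \<theta> (norm ?y)) + k * R2 * norm u"
      by (simp add: distrib_left)
    also have "k * R2 * (norm ?y + \<theta> (norm ?y)) \<le> \<eta> / 2 + \<Lambda> * (norm ?y * \<alpha> (norm ?y))"
      using ny by (intro y_bound) simp
    finally have 1: "2 * b x (A *v x + B *v u - B *v w) \<le>
        - \<eta> / 2 + \<Lambda> * (norm ?y * \<alpha> (norm ?y)) + k * R2 * norm u"
      by simp
    have "\<Lambda> * stor x (A *v x + B *v u - B *v w) \<le>
        \<Lambda> * (norm ?y * norm u - norm ?y * \<alpha> (norm ?y))"
      by (intro mult_left_mono storage_rate w nn)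
    moreover have "\<Lambda> * (norm ?y * norm u) \<le> \<Lambda> * ((c * R1) * norm u)"
      using nn ny by (intro mult_left_mono mult_right_mono) auto
    ultimately have 2: "\<Lambda> * stor x (A *v x + B *v u - B *v w) \<le>
        \<Lambda> * c * R1 * norm u - \<Lambda> * (norm ?y * \<alpha> (norm ?y))"
      by (simp add: right_diff_distrib mult.assoc)
    show ?thesis
      using 1 2 by (simp add: S_def M_def distrib_left distrib_right)
  qed
  \<comment> \<open>The form \<open>S\<close> starts at most at \<open>KS * R2 * R2\<close>, gains
    at most \<open>M * R\<close> from the input and loses \<open>\<eta> / 2\<close> per unit time.
    The summand 1 makes the contradiction strict.\<close>
  define T where "T = 2 * (KS * R2 * R2 + M * R) / \<eta> + 1"
  have "0 \<le> T"
    using KS R nn \<open>0 < \<eta>\<close> assms by (simp add: T_def)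
  moreover have "nrm (x t) \<le> \<epsilon> + (1 + 2 * c) * integral {0..t} (\<lambda>s. norm (v s))"
    if vx: "(v, x) \<in> B_inc A B C (F0 \<theta> \<alpha>)" and x0: "nrm (x 0) \<le> R" and t: "T \<le> t" for v x t
  proof -
    define D where "D u w = integral {u..w} (\<lambda>s. norm (v s))" for u w
    obtain dx N where v: "v \<in> L1_loc" and x: "has_L1_loc_derivative x dx"
      and N: "negligible N"
        "\<And>s. 0 \<le> s \<Longrightarrow> s \<notin> N \<Longrightarrow>
           \<exists>w\<in>F0 \<theta> \<alpha> (C *v x s). dx s = A *v x s + B *v v s - B *v w"
      using B_incE[OF vx] by blast
    note int = input_integrable[OF v]
    have "0 \<le> t"
      using \<open>0 \<le> T\<close> t by simp
    have D_mono: "D u w \<le> D 0 t" if "0 \<le> u" "w \<le> t" for u w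
      unfolding D_def using that by (intro integral_subset_le int) auto
    have D_nonneg: "0 \<le> D 0 t"
      unfolding D_def by (intro integral_nonneg int) auto
    have growth: "nrm (x w) \<le> nrm (x u) + 2 * c * D 0 t" if "0 \<le> u" "u \<le> w" "w \<le> t" for u w
    proof -
      have "2 * c * D u w \<le> 2 * c * D 0 t"
        using c(1) by (intro mult_left_mono D_mono that) auto
      with nrm_growth[OF vx that(1,2)] show ?thesis
        by (simp only: D_def)
    qed
    show ?thesis
    proof (cases "nrm (x 0) \<le> D 0 t")
      \<comment> \<open>The input integral absorbs the initial value, hence the summand 1 in the
        gain.\<close>
      case True
      then show ?thesis
        using growth[of 0 t] \<open>0 \<le> t\<close> \<open>0 < \<epsilon>\<close> by (simp add: D_def distrib_right)
    next
      case False
      then have "D 0 t \<le> R"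
        using x0 by simp
      have "\<exists>s\<in>{0..t}. nrm (x s) < \<epsilon>"
      proof (rule ccontr)
        assume "\<not> ?thesis"
        then have far: "\<epsilon> \<le> nrm (x s)" if "s \<in> {0..t}" for s
          using that by force
        have near: "nrm (x s) \<le> R1" if "s \<in> {0..t}" for s
        proof -
          have "2 * c * D 0 t \<le> 2 * c * R"
            using \<open>D 0 t \<le> R\<close> c(1) by simp
          then show ?thesis
            using growth[of 0 s] that x0 by (simp add: R1_def distrib_right)
        qed
        have "S (x t) (x t) - S (x 0) (x 0) \<le> integral {0..t} (\<lambda>s. - \<eta> / 2 + M * norm (v s))"
        proof (rule quadratic_form_increment_le[OF S(1,2) x _ \<open>0 \<le> t\<close> _ N(1)])
          show "(\<lambda>s. - \<eta> / 2 + M * norm (v s)) integrable_on {0..t}"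
            by (intro integrable_add integrable_on_mult_right int) auto
          fix s assume s: "s \<in> {0..t} - N"
          then obtain w where "w \<in> F0 \<theta> \<alpha> (C *v x s)" "dx s = A *v x s + B *v v s - B *v w"
            using N(2)[of s] by auto
          then show "2 * S (x s) (dx s) \<le> - \<eta> / 2 + M * norm (v s)"
            using rate[of "x s" w "v s"] far[of s] near[of s] s by simp
        qed simp
        also have "\<dots> = t * (- \<eta> / 2) + M * D 0 t"
          using \<open>0 \<le> t\<close> int[of 0 t]
          by (subst integral_add) (auto intro!: integrable_on_mult_right simp: D_def)
        also have "M * D 0 t \<le> M * R"
          using nn \<open>D 0 t \<le> R\<close> by (intro mult_left_mono) auto
        finally have "t * \<eta> / 2 \<le> S (x 0) (x 0) + M * R"
          using S(3)[of "x t"] by simp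
        also have "S (x 0) (x 0) \<le> KS * R2 * R2"
        proof -
          have "p * norm (x 0) \<le> R1"
            using near[of 0] p(2)[of "x 0"] \<open>0 \<le> t\<close> by simp
          then have "norm (x 0) \<le> R2"
            using p(1) by (simp add: R2_def field_simps)
          then have "KS * norm (x 0) * norm (x 0) \<le> KS * R2 * R2"
            using KS(1) R by (intro mult_mono) auto
          then show ?thesis
            using KS(2)[of "x 0" "x 0"] by linarith
        qed
        finally have "t \<le> 2 * (KS * R2 * R2 + M * R) / \<eta>"
          using \<open>0 < \<eta>\<close> by (simp add: field_simps)
        with t show False
          by (simp add: T_def)
      qed
      then obtain s where s: "s \<in> {0..t}" "nrm (x s) < \<epsilon>"
        by blast
      then show ?thesis
        using growth[of s t] D_nonneg by (simp add: D_def distrib_right)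
    qed
  qed
  ultimately show ?thesis
    by blast
qed

lemma IISS: "IISS_linear_gain (B_inc A B C (F0 \<theta> \<alpha>))"
proof -
  let ?\<B> = "B_inc A B C (F0 \<theta> \<alpha>)"
  \<comment> \<open>The gain for \<open>nrm\<close> is \<open>1 + 2 * c\<close>; division by
    \<open>p\<close> passes to the Euclidean norm.\<close>
  define g where "g = (1 + 2 * c) / p"
  have "0 < g"
    using c(1) p(1) by (simp add: g_def)
  define D :: "(real \<Rightarrow> real^'m) \<Rightarrow> real \<Rightarrow> real" where "D v t = integral {0..t} (\<lambda>s. norm (v s))" for v t
  have D_nonneg: "0 \<le> D v t" if "(v, x) \<in> ?\<B>" for v x t
    using that unfolding D_def B_inc_def by (intro integral_nonneg input_integrable) auto
  \<comment> \<open>Subtracting the input contribution leaves a family to be bounded by initial norm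
    and time alone. Taking all trajectories at once gives one \<open>\<psi>\<close> for all of
    them.\<close>
  define S where "S = (\<lambda>(v, x). (norm (x 0), \<lambda>t. norm (x t) - g * D v t)) ` ?\<B>"
  have "\<exists>\<psi>\<in>class_KL. \<forall>(r, f)\<in>S. \<forall>t\<ge>0. f t \<le> \<psi> r t"
  proof (rule class_KL_bound_exists[where \<kappa> = "q / p"])
    fix r f assume "(r, f) \<in> S"
    then obtain v x where vx: "(v, x) \<in> ?\<B>" and rf: "r = norm (x 0)"
      "f = (\<lambda>t. norm (x t) - g * D v t)"
      unfolding S_def by auto
    show "0 \<le> r"
      by (simp add: rf)
    fix t :: real assume "0 \<le> t"
    have "p * norm (x t) \<le> q * norm (x 0) + 2 * c * D v t"
      using nrm_growth[OF vx order_refl \<open>0 \<le> t\<close>] p(2)[of "x t"] q(2)[of "x 0"] by (simp add: D_def)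
    also have "\<dots> \<le> q * norm (x 0) + (1 + 2 * c) * D v t"
      using D_nonneg[OF vx, of t] by (simp add: distrib_right)
    finally have "norm (x t) \<le> (q * norm (x 0) + (1 + 2 * c) * D v t) / p"
      using p(1) by (simp add: pos_le_divide_eq mult.commute)
    also have "\<dots> = q / p * norm (x 0) + g * D v t"
      by (simp add: g_def add_divide_distrib[of "q * norm (x 0)"])
    finally show "f t \<le> q / p * r"
      by (simp add: rf)
  next
    fix R \<epsilon> :: real assume "0 < \<epsilon>"
    \<comment> \<open>The maximum is there because \<open>R\<close> may be negative;
      \<open>p * \<epsilon>\<close> becomes \<open>\<epsilon>\<close> after division by
      \<open>p\<close>.\<close>
    then obtain T where T: "0 \<le> T" "\<And>v x t. (v, x) \<in> ?\<B> \<Longrightarrow> nrm (x 0) \<le> q * max 0 R \<Longrightarrow> T \<le> t \<Longrightarrow>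
        nrm (x t) \<le> p * \<epsilon> + (1 + 2 * c) * integral {0..t} (\<lambda>s. norm (v s))"
      using uniform_attractivity[of "q * max 0 R" "p * \<epsilon>"] p(1) q(1) by fastforce
    have "norm (x t) - g * D v t \<le> \<epsilon>" if "(v, x) \<in> ?\<B>" "norm (x 0) \<le> R" "T \<le> t" for v x t
    proof -
      have "nrm (x 0) \<le> q * max 0 R"
        using q(1) that(2) by (intro order_trans[OF q(2) mult_left_mono]) auto
      then have "p * norm (x t) \<le> p * \<epsilon> + (1 + 2 * c) * D v t"
        using T(2)[OF that(1) _ that(3)] p(2)[of "x t"] by (simp add: D_def)
      then show ?thesis
        using p(1) by (simp add: g_def field_simps)
    qed
    then show "\<exists>T. \<forall>(r, f)\<in>S. r \<le> R \<longrightarrow> (\<forall>t\<ge>T. f t \<le> \<epsilon>)"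
      unfolding S_def by (intro exI[of _ T]) auto
  qed (use p q in simp)
  then obtain \<psi> where \<psi>: "\<psi> \<in> class_KL" "\<And>r f t. (r, f) \<in> S \<Longrightarrow> 0 \<le> t \<Longrightarrow> f t \<le> \<psi> r t"
    by blast
  have "norm (x t) \<le> \<psi> (norm (x 0)) t + g * integral {0..t} (\<lambda>s. norm (v s))"
    if "(v, x) \<in> ?\<B>" "0 \<le> t" for v x t
    using \<psi>(2)[of "norm (x 0)" "\<lambda>t. norm (x t) - g * D v t" t] that
    unfolding S_def by (force simp: D_def)
  moreover have "(\<lambda>s. g * s) \<in> class_K"
    using \<open>0 < g\<close> by (auto simp: class_K_def class_P_def intro!: continuous_intros strict_mono_onI)
  ultimately show ?thesis
    unfolding IISS_linear_gain_def using \<psi>(1) by (intro bexI[of _ \<psi>] bexI[of _ "\<lambda>s. g * s"]) auto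
qed

end

section \<open>From the matrix hypotheses to the quadratic forms and constants\<close>

theorem theorem3p7:
  fixes A :: "real^'n^'n" and B :: "real^'m^'n" and C :: "real^'n^'m"
    and \<theta> \<alpha> :: "real \<Rightarrow> real"
  assumes "\<theta> \<in> class_K_inf"
    and "\<alpha> \<in> class_P"
    and "\<forall>s\<ge>0. \<alpha> s \<le> \<theta> s"
    and "mono_on {0..} (\<lambda>s. sqrt ((\<theta> s)\<^sup>2 - (\<alpha> s)\<^sup>2))"
    and "local_lipschitz (UNIV::real set) {0..} (\<lambda>_ s. sqrt ((\<theta> s)\<^sup>2 - (\<alpha> s)\<^sup>2))"
    and "detectable C A"
    and "\<exists>P::real^'n^'n. pos_definite P \<and>
           neg_semidefinite
             (block_matrix (transpose A ** P + P ** A) (P ** B - transpose C)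
                           (transpose B ** P - C) 0)"
  shows "IISS_linear_gain (B_inc A B C (F0 \<theta> \<alpha>))"
proof -
  obtain P where P: "pos_definite P" "neg_semidefinite
      (block_matrix (transpose A ** P + P ** A) (P ** B - transpose C) (transpose B ** P - C) 0)"
    using assms(7) by blast
  then have P_sym: "transpose P = P"
    by (simp add: pos_definite_def)
  obtain H where "hurwitz (A - H ** C)"
    using assms(6) by (auto simp: detectable_def)
  from hurwitz_imp_lyapunov_form[OF this] obtain b where
    b: "bilinear b" "\<And>x y. b x y = b y x" "\<And>x. 0 \<le> b x x"
      "\<And>x. 2 * b x ((A - H ** C) *v x) \<le> - (norm x)\<^sup>2"
    by blast
  obtain p where p: "0 < p" "\<And>x. p * norm x \<le> sqrt (x \<bullet> (P *v x))"
    using pos_definite_coercive[OF P(1)] by blast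
  obtain K where K: "0 < K" "\<And>x. norm (P *v x) \<le> K * norm x"
    using linear_bounded_pos[of "(*v) P"] by (auto simp: mult.commute)
  have q: "sqrt (x \<bullet> (P *v x)) \<le> sqrt K * norm x" for x
  proof -
    have "x \<bullet> (P *v x) \<le> norm x * (K * norm x)"
      using norm_cauchy_schwarz[of x "P *v x"] mult_left_mono[OF K(2)[of x], of "norm x"] by simp
    then have "sqrt (x \<bullet> (P *v x)) \<le> sqrt (K * (norm x)\<^sup>2)"
      by (simp add: power2_eq_square mult_ac)
    then show ?thesis
      by (simp add: real_sqrt_mult)
  qed
  obtain L where L: "0 < L" "\<And>x. norm (C *v x) \<le> L * norm x"
    using linear_bounded_pos[of "(*v) C"] by (auto simp: mult.commute)
  have c: "norm (C *v x) \<le> L / p * sqrt (x \<bullet> (P *v x))" for x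
  proof -
    have "p * norm (C *v x) \<le> L * (p * norm x)"
      using mult_left_mono[OF L(2)[of x], of p] p(1) by (simp add: mult_ac)
    also have "\<dots> \<le> L * sqrt (x \<bullet> (P *v x))"
      using L(1) by (intro mult_left_mono p) auto
    finally show ?thesis
      using p(1) by (simp add: field_simps)
  qed
  interpret passive_lure_system A B C \<theta> \<alpha> P H b p "sqrt K" "L / p"
    using assms(1,2) b p q c L(1) K(1) passivity_of_block_matrix[OF P_sym P(2)] P_sym
    by unfold_locales (auto simp: class_K_inf_def class_K_def class_P_def)
  show ?thesis
    by (rule IISS)
qed

end
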